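(* Let $A\in\mathbb{C}^{N\times N}$, $\mathbf r_0\in\mathbb{C}^N$, $S\in\mathbb{C}^{s\times N}$, and let $V_m\in\mathbb{C}^{N\times m}$ be a matrix whose columns form a (not necessarily orthogonal) basis of the Krylov subspace $\mathcal K_m=\mathcal{K}_m(A,\mathbf r_0)$. Define $$\widehat{\Phi}_{\mathcal K_m}=AV_m(SAV_m)^\dagger S,\qquad \widehat{\Pi}_{\mathcal K_m}=V_m(SAV_m)^\dagger SA .$$ Then $\widehat{\Pi}_{\mathcal K_m}$ and $\widehat{\Phi}_{\mathcal K_m}$ are both projectors. Moreover, $\mathrm{Range}(\widehat{\Phi}_{\mathcal K_m})\subseteq \mathrm{Range}(AV_m)$ and the null space of $\widehat{\Phi}_{\mathcal K_m}$ contains $\mathrm{Range}(S^*SAV_m)^\perp$; and $\mathrm{Range}(\widehat{\Pi}_{\mathcal K_m})\subseteq \mathrm{Range}(V_m)$ and the null space of $\widehat{\Pi}_{\mathcal K_m}$ contains $\mathrm{Range}(A^*S^*SAV_m)^\perp$.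
   Context: $\mathcal{K}_m(A,\mathbf r_0)=\mathrm{span}\{\mathbf r_0,A\mathbf r_0,\ldots,A^{m-1}\mathbf r_0\}$. The superscript $\dagger$ denotes the Moore--Penrose pseudoinverse, $*$ the conjugate transpose, and $\perp$ the orthogonal complement in the Euclidean inner product. A projector is an idempotent matrix ($P^2=P$), not necessarily orthogonal. *)

theory Defs
  imports "Jordan_Normal_Form.Schur_Decomposition" "Jordan_Normal_Form.Matrix_Kernel"
begin

definition krylov :: "complex mat \<Rightarrow> complex vec \<Rightarrow> nat \<Rightarrow> complex vec set" where
  "krylov A r m =
     LinearCombinations.module.span class_ring (module_vec TYPE(complex) (dim_vec r))
       {(A ^\<^sub>m i) *\<^sub>v r | i. i < m}"

text \<open>The distinctness condition makes the columns a basis as an indexed family: the library's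
  \<open>basis\<close> predicate is about sets and would not notice repeated columns.\<close>

definition columns_form_basis :: "complex mat \<Rightarrow> complex vec set \<Rightarrow> bool" where
  "columns_form_basis V W \<longleftrightarrow>
     distinct (cols V) \<and>
     vectorspace.basis class_ring (module_vec TYPE(complex) (dim_row V)\<lparr>carrier := W\<rparr>)
       (set (cols V))"

definition is_pinv :: "complex mat \<Rightarrow> complex mat \<Rightarrow> bool" where
  "is_pinv M X \<longleftrightarrow>
     X \<in> carrier_mat (dim_col M) (dim_row M) \<and>
     M * X * M = M \<and> X * M * X = X \<and>
     mat_adjoint (M * X) = M * X \<and> mat_adjoint (X * M) = X * M"

text \<open>Every complex matrix has exactly one matrix satisfying the four Penrose conditions.\<close>

definition pinv :: "complex mat \<Rightarrow> complex mat" where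
  "pinv M = (THE X. is_pinv M X)"

definition projector :: "complex mat \<Rightarrow> bool" where
  "projector P \<longleftrightarrow> square_mat P \<and> P * P = P"

abbreviation mat_range :: "complex mat \<Rightarrow> complex vec set" where
  "mat_range M \<equiv> vec_space.col_space (dim_row M) M"

text \<open>The library's \<open>orthogonal_complement\<close> uses the bilinear product without conjugation,
  hence this Hermitian version.\<close>

definition orth_compl :: "nat \<Rightarrow> complex vec set \<Rightarrow> complex vec set" where
  "orth_compl n W = {x \<in> carrier_vec n. \<forall>y \<in> W. x \<bullet>c y = 0}"

definition Phi_hat :: "complex mat \<Rightarrow> complex mat \<Rightarrow> complex mat \<Rightarrow> complex mat" where
  "Phi_hat A S V = A * V * pinv (S * A * V) * S"

definition Pi_hat :: "complex mat \<Rightarrow> complex mat \<Rightarrow> complex mat \<Rightarrow> complex mat" where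
  "Pi_hat A S V = V * pinv (S * A * V) * S * A"

end

theory Submission
  imports Defs
begin

text \<open>With \<open>M = S A V\<close>, idempotence of both matrices is the Penrose identity \<open>M\<^sup>\<dagger> M M\<^sup>\<dagger> = M\<^sup>\<dagger>\<close>, and
  the null space inclusions come from \<open>M\<^sup>\<dagger> = M\<^sup>\<dagger> (M\<^sup>\<dagger>)\<^sup>* M\<^sup>*\<close>: a vector \<open>x\<close> orthogonal to the range
  of \<open>S\<^sup>* M\<close> satisfies \<open>M\<^sup>* S x = 0\<close>, hence \<open>M\<^sup>\<dagger> S x = 0\<close>. Existence of \<open>M\<^sup>\<dagger>\<close> is obtained from an
  arbitrary generalized inverse \<open>B\<close> of \<open>M\<^sup>* M\<close>, supplied by the row echelon form:
  \<open>B M\<^sup>*\<close> satisfies \<open>M (B M\<^sup>*) M = M\<close> and \<open>M (B M\<^sup>*)\<close> is Hermitian; combining it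
  with the same construction for \<open>M\<^sup>*\<close> gives all four Penrose conditions.\<close>

text \<open>The side conditions speak of dimensions only, without extra size parameters, so simp can
  reassociate products with this rule in either direction.\<close>

lemma mat_mult_assoc_dims:
  fixes A B C :: "'a :: semiring_0 mat"
  assumes "dim_col A = dim_row B" "dim_col B = dim_row C"
  shows "A * B * C = A * (B * C)"
  by (rule assoc_mult_mat[of A "dim_row A" "dim_row B" B "dim_row C" C "dim_col C"]) (use assms in auto)

subsection \<open>Adjoint matrices\<close>

lemma dim_mat_adjoint [simp]:
  "dim_row (mat_adjoint A) = dim_col A" "dim_col (mat_adjoint A) = dim_row A"
  by (simp_all add: mat_adjoint_def)

lemma index_mat_adjoint [simp]:
  assumes "i < dim_col A" "j < dim_row A"
  shows "mat_adjoint A $$ (i, j) = conjugate (A $$ (j, i))"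
  using assms by (simp add: mat_adjoint_def mat_of_rows_index)

lemma mat_adjoint_carrier [simp]:
  "A \<in> carrier_mat n m \<Longrightarrow> mat_adjoint A \<in> carrier_mat m n"
  by auto

lemma mat_adjoint_adjoint [simp]: "mat_adjoint (mat_adjoint A) = A"
  by (rule eq_matI) auto

lemma mat_adjoint_mult:
  fixes A B :: "'a :: conjugatable_field mat"
  assumes "dim_col A = dim_row B"
  shows "mat_adjoint (A * B) = mat_adjoint B * mat_adjoint A"
proof (rule eq_matI)
  fix i j assume ij: "i < dim_row (mat_adjoint B * mat_adjoint A)" "j < dim_col (mat_adjoint B * mat_adjoint A)"
  have "mat_adjoint (A * B) $$ (i, j) = conjugate (\<Sum>k<dim_row B. A $$ (j, k) * B $$ (k, i))"
    using ij assms by (simp add: scalar_prod_def atLeast0LessThan)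
  also have "\<dots> = (\<Sum>k<dim_row B. conjugate (B $$ (k, i)) * conjugate (A $$ (j, k)))"
    by (simp add: sum_conjugate conjugate_dist_mul mult.commute)
  also have "\<dots> = (mat_adjoint B * mat_adjoint A) $$ (i, j)"
    using ij assms by (simp add: scalar_prod_def atLeast0LessThan)
  finally show "mat_adjoint (A * B) $$ (i, j) = (mat_adjoint B * mat_adjoint A) $$ (i, j)" .
qed auto

text \<open>The diagonal entries of \<open>mat_adjoint Y * Y\<close> are the squared norms of the
  columns of \<open>Y\<close>.\<close>

lemma adjoint_mult_self_eq_0:
  fixes Y :: "'a :: conjugatable_ordered_field mat"
  assumes Y: "Y \<in> carrier_mat n m" and 0: "mat_adjoint Y * Y = 0\<^sub>m m m"
  shows "Y = 0\<^sub>m n m"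
proof (rule eq_matI)
  fix i j assume ij: "i < dim_row (0\<^sub>m n m :: 'a mat)" "j < dim_col (0\<^sub>m n m :: 'a mat)"
  have "(mat_adjoint Y * Y) $$ (j, j) = col Y j \<bullet>c col Y j"
    using Y ij by (simp add: scalar_prod_def mult.commute)
  hence "col Y j \<bullet>c col Y j = 0" using 0 ij by simp
  hence "col Y j = 0\<^sub>v n" using Y by (subst (asm) conjugate_square_eq_0_vec[of _ n]) auto
  hence "col Y j $ i = 0" using ij by simp
  thus "Y $$ (i, j) = 0\<^sub>m n m $$ (i, j)" using Y ij by simp
qed (use Y in auto)

text \<open>\<open>mat_adjoint M\<close> is injective on the range of \<open>M\<close>: the Gram
  matrix of \<open>M * (X - Y)\<close> vanishes, hence so does \<open>M * (X - Y)\<close>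
  itself.\<close>

lemma adjoint_mult_left_cancel:
  fixes M X Y :: "'a :: conjugatable_ordered_field mat"
  assumes M: "M \<in> carrier_mat n m" and X: "X \<in> carrier_mat m k" and Y: "Y \<in> carrier_mat m k"
    and eq: "mat_adjoint M * (M * X) = mat_adjoint M * (M * Y)"
  shows "M * X = M * Y"
proof -
  have "M * (X - Y) = 0\<^sub>m n k"
  proof (rule adjoint_mult_self_eq_0)
    have "mat_adjoint M * (M * (X - Y)) = mat_adjoint M * (M * X) - mat_adjoint M * (M * Y)"
      using M X Y by (simp add: mult_minus_distrib_mat[of _ n m] mult_minus_distrib_mat[of _ m n "M * X" k])
    also have "\<dots> = 0\<^sub>m m k"
      unfolding eq using M Y by (intro minus_r_inv_mat) auto
    finally have "mat_adjoint M * (M * (X - Y)) = 0\<^sub>m m k" .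
    thus "mat_adjoint (M * (X - Y)) * (M * (X - Y)) = 0\<^sub>m k k"
      using M X Y by (simp add: mat_adjoint_mult mat_mult_assoc_dims)
  qed (use M X Y in auto)
  hence 0: "M * X - M * Y = 0\<^sub>m n k"
    using M X Y by (simp add: mult_minus_distrib_mat[of _ n m])
  show ?thesis
  proof (rule eq_matI)
    fix i j assume ij: "i < dim_row (M * Y)" "j < dim_col (M * Y)"
    have "(M * X - M * Y) $$ (i, j) = 0" unfolding 0 using ij M Y by simp
    thus "(M * X) $$ (i, j) = (M * Y) $$ (i, j)" using ij M X Y by simp
  qed (use M X Y in auto)
qed

subsection \<open>Generalized inverses\<close>

text \<open>The echelon form is reduced, so every pivot column is a unit vector. Selecting the pivot
  columns makes \<open>C * E\<close> diagonal with 1 exactly at the nonzero rows, and such a matrix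
  fixes \<open>C\<close> from the left.\<close>

lemma row_echelon_generalized_inverse:
  fixes C :: "'a :: field mat"
  assumes C: "C \<in> carrier_mat nr nc" and ech: "row_echelon_form C"
  shows "\<exists>E \<in> carrier_mat nc nr. C * E * C = C"
proof -
  from ech C obtain f where "pivot_fun C f nc" unfolding row_echelon_form_def by auto
  note piv = pivot_funD[OF _ this, of nr]
  \<comment> \<open>The value \<open>f i = nc\<close> marks a zero row; column \<open>i\<close> of
    \<open>E\<close> is then zero, since \<open>j\<close> stays below \<open>nc\<close>.\<close>
  define E :: "'a mat" where "E = mat nc nr (\<lambda>(j, i). if j = f i then 1 else 0)"
  have E: "E \<in> carrier_mat nc nr" by (simp add: E_def)
  have CE: "(C * E) $$ (i, k) = (if i = k \<and> f i < nc then 1 else 0)" if "i < nr" "k < nr" for i k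
  proof -
    have "(C * E) $$ (i, k) = (\<Sum>j<nc. C $$ (i, j) * (if j = f k then 1 else 0))"
      using C E that by (simp add: scalar_prod_def E_def atLeast0LessThan)
    also have "\<dots> = (if f k < nc then C $$ (i, f k) else 0)"
      by (simp add: if_distrib[of "\<lambda>x. _ * x"] cong: if_cong)
    also have "\<dots> = (if i = k \<and> f i < nc then 1 else 0)"
      using piv(4,5)[of k] C that by auto
    finally show ?thesis .
  qed
  define D where "D = C * E"
  have D: "D \<in> carrier_mat nr nr" using C E by (simp add: D_def)
  have "D * C = C"
  proof (rule eq_matI)
    fix i l assume il: "i < dim_row C" "l < dim_col C"
    have "(D * C) $$ (i, l) = (\<Sum>k<nr. D $$ (i, k) * C $$ (k, l))"
      using C D il by (simp add: scalar_prod_def atLeast0LessThan)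
    also have "\<dots> = (\<Sum>k<nr. if k = i then (if f i < nc then C $$ (i, l) else 0) else 0)"
      unfolding D_def using C il by (intro sum.cong) (auto simp: CE simp del: index_mult_mat(1))
    also have "\<dots> = C $$ (i, l)"
      using piv(1)[of i] piv(2)[of i l] C il by auto
    finally show "(D * C) $$ (i, l) = C $$ (i, l)" .
  qed (use C D in auto)
  hence "C * E * C = C" unfolding D_def .
  with E show ?thesis by blast
qed

text \<open>Row reduction gives \<open>C = P * M\<close> with \<open>P\<close> invertible, and a
  generalized inverse \<open>E\<close> of \<open>C\<close> turns into \<open>E * P\<close> for
  \<open>M\<close>.\<close>

lemma ex_generalized_inverse:
  fixes M :: "'a :: field mat"
  assumes M: "M \<in> carrier_mat nr nc"
  shows "\<exists>G \<in> carrier_mat nc nr. M * G * M = M"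
proof -
  \<comment> \<open>\<open>gauss_jordan\<close> transforms a pair of matrices; the second one is a
    placeholder without columns.\<close>
  obtain C D where gj: "gauss_jordan M (0\<^sub>m nr 0) = (C, D)" by fastforce
  from gauss_jordan_transform[OF M _ gj, of 0, unfolded ring_mat_def Units_def, simplified]
  obtain P Q where P: "P \<in> carrier_mat nr nr" and Q: "Q \<in> carrier_mat nr nr"
    and QP: "Q * P = 1\<^sub>m nr" and C: "C = P * M" by auto
  have "row_echelon_form C" by (rule gauss_jordan_row_echelon[OF M gj])
  then obtain E where E: "E \<in> carrier_mat nc nr" and CEC: "C * E * C = C"
    using row_echelon_generalized_inverse[of C nr nc] C P M by auto
  have "M * (E * P) * M = Q * P * (M * (E * P) * M)" using QP M E P by simp
  also have "\<dots> = Q * (C * E * C)" unfolding C using P Q M E by (simp add: mat_mult_assoc_dims)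
  also have "\<dots> = Q * P * M" unfolding CEC using P Q M by (simp add: C mat_mult_assoc_dims)
  also have "\<dots> = M" using QP M by simp
  finally show ?thesis using E P by (intro bexI[of _ "E * P"]) auto
qed

lemma ex_hermitian_generalized_inverse:
  fixes M :: "'a :: conjugatable_ordered_field mat"
  assumes M: "M \<in> carrier_mat n m"
  shows "\<exists>X \<in> carrier_mat m n. M * X * M = M \<and> mat_adjoint (M * X) = M * X"
proof -
  let ?M' = "mat_adjoint M"
  obtain B where B: "B \<in> carrier_mat m m" and g: "?M' * M * B * (?M' * M) = ?M' * M"
    using ex_generalized_inverse[OF mult_carrier_mat[OF mat_adjoint_carrier[OF M] M]] by blast
  define X where "X = B * ?M'"
  have X: "X \<in> carrier_mat m n" using B M by (auto simp: X_def)
  have "M * (X * M) = M * 1\<^sub>m m"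
  proof (rule adjoint_mult_left_cancel[OF M])
    show "?M' * (M * (X * M)) = ?M' * (M * 1\<^sub>m m)"
      using g M B by (simp add: X_def mat_mult_assoc_dims)
  qed (use X M in auto)
  hence MXM: "M * X * M = M" using M X by (simp add: mat_mult_assoc_dims)
  \<comment> \<open>As \<open>mat_adjoint M * M\<close> is Hermitian, taking adjoints in
    \<open>g\<close> shows that \<open>mat_adjoint B\<close> is a generalized inverse of it
    too.\<close>
  have "M * (mat_adjoint B * (?M' * M)) = M * 1\<^sub>m m"
  proof (rule adjoint_mult_left_cancel[OF M])
    have "?M' * (M * (mat_adjoint B * (?M' * M))) = mat_adjoint (?M' * M * B * (?M' * M))"
      using M B by (simp add: mat_adjoint_mult mat_mult_assoc_dims)
    also have "\<dots> = ?M' * M" unfolding g using M by (simp add: mat_adjoint_mult)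
    finally show "?M' * (M * (mat_adjoint B * (?M' * M))) = ?M' * (M * 1\<^sub>m m)" using M by simp
  qed (use B M in auto)
  hence adj: "mat_adjoint (M * X) * M = M"
    using M B by (simp add: X_def mat_adjoint_mult mat_mult_assoc_dims)
  \<comment> \<open>\<open>M * X\<close> equals its own Gram matrix, and Gram matrices are
    Hermitian.\<close>
  have "mat_adjoint (M * X) * (M * X) = M * X"
    using adj M X by (simp flip: mat_mult_assoc_dims)
  moreover have "mat_adjoint (mat_adjoint (M * X) * (M * X)) = mat_adjoint (M * X) * (M * X)"
    using M X by (simp add: mat_adjoint_mult)
  ultimately have "mat_adjoint (M * X) = M * X" by simp
  with X MXM show ?thesis by blast
qed

section \<open>Existence and uniqueness of the pseudoinverse\<close>

lemma ex_is_pinv: "\<exists>X. is_pinv M X"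
proof -
  obtain n m where M: "M \<in> carrier_mat n m" by blast
  obtain X where X: "X \<in> carrier_mat m n" "M * X * M = M" "mat_adjoint (M * X) = M * X"
    using ex_hermitian_generalized_inverse[OF M] by blast
  obtain Z where Z: "Z \<in> carrier_mat n m" "mat_adjoint M * Z * mat_adjoint M = mat_adjoint M"
      "mat_adjoint (mat_adjoint M * Z) = mat_adjoint M * Z"
    using ex_hermitian_generalized_inverse[OF mat_adjoint_carrier[OF M]] by blast
  \<comment> \<open>\<open>Y\<close> mirrors \<open>X\<close>: a generalized inverse of
    \<open>M\<close> for which \<open>Y * M\<close> is Hermitian.\<close>
  define Y where "Y = mat_adjoint Z"
  have Y: "Y \<in> carrier_mat m n" using Z by (simp add: Y_def)
  have "mat_adjoint (mat_adjoint M * Z * mat_adjoint M) = M" unfolding Z(2) by simp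
  hence MYM: "M * (Y * M) = M" using M Z(1) by (simp add: Y_def mat_adjoint_mult)
  have YM: "mat_adjoint (Y * M) = Y * M"
    using Z(1,3) M by (simp add: Y_def mat_adjoint_mult)
  have MXM: "M * (X * M) = M" using X M by (simp add: mat_mult_assoc_dims)
  have MYMX: "M * (Y * (M * X)) = M * X"
    using arg_cong[OF MYM, of "\<lambda>T. T * X"] M X Y by (simp add: mat_mult_assoc_dims)
  \<comment> \<open>\<open>M * ?P\<close> collapses to \<open>M * X\<close> and
    \<open>?P * M\<close> to \<open>Y * M\<close>, so one Hermitian condition comes from
    \<open>X\<close> and the other from \<open>Y\<close>.\<close>
  let ?P = "Y * M * X"
  have a: "M * ?P = M * X" using MYMX M X Y by (simp add: mat_mult_assoc_dims)
  have b: "?P * M = Y * M" using MXM M X Y by (simp add: mat_mult_assoc_dims)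
  have "?P * M * ?P = ?P" unfolding b using MYMX M X Y by (simp add: mat_mult_assoc_dims)
  hence "is_pinv M ?P" unfolding is_pinv_def a b using M X Y YM by auto
  thus ?thesis ..
qed

text \<open>Taking adjoints swaps the Hermitian factors in \<open>(M * Y) * (M * X)\<close>, which
  turns \<open>M * X\<close> into \<open>M * Y\<close>. Likewise \<open>X * M = Y * M\<close>, and
  then \<open>X = X * M * X\<close> becomes \<open>Y\<close>.\<close>

lemma is_pinv_unique:
  assumes X: "is_pinv M X" and Y: "is_pinv M Y"
  shows "X = Y"
proof -
  have d: "dim_row X = dim_col M" "dim_col X = dim_row M"
    "dim_row Y = dim_col M" "dim_col Y = dim_row M"
    using X Y by (auto simp: is_pinv_def)
  note x = X[unfolded is_pinv_def] and y = Y[unfolded is_pinv_def]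
  have "M * X = (M * Y) * (M * X)" using y d by (simp flip: mat_mult_assoc_dims)
  also have "\<dots> = mat_adjoint ((M * X) * (M * Y))" using x y d by (simp add: mat_adjoint_mult)
  also have "(M * X) * (M * Y) = M * Y" using x d by (simp flip: mat_mult_assoc_dims)
  finally have MX: "M * X = M * Y" using y by simp
  have "X * M = (X * M) * (Y * M)" using y d by (simp add: mat_mult_assoc_dims)
  also have "\<dots> = mat_adjoint ((Y * M) * (X * M))" using x y d by (simp add: mat_adjoint_mult)
  also have "(Y * M) * (X * M) = Y * M" using x d by (simp add: mat_mult_assoc_dims)
  finally have XM: "X * M = Y * M" using y by simp
  have "X = X * M * X" using x by simp
  also have "\<dots> = Y * (M * X)" unfolding XM using d by (simp add: mat_mult_assoc_dims)
  also have "\<dots> = Y" unfolding MX using y d by (simp flip: mat_mult_assoc_dims)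
  finally show ?thesis .
qed

lemma is_pinv_pinv: "is_pinv M (pinv M)"
  unfolding pinv_def using ex_is_pinv is_pinv_unique by (metis (no_types, lifting) theI)

subsection \<open>Ranges and null spaces\<close>

lemma mat_range_eq: "mat_range M = {M *\<^sub>v x | x. x \<in> carrier_vec (dim_col M)}"
proof -
  interpret vec_space "TYPE(complex)" "dim_row M" .
  show ?thesis by (subst col_space_eq[of M "dim_col M"]) (auto intro!: carrier_vecI)
qed

lemma mat_range_mult_subset:
  assumes "dim_col A = dim_row B"
  shows "mat_range (A * B) \<subseteq> mat_range A"
proof
  fix y assume "y \<in> mat_range (A * B)"
  then obtain x where x: "x \<in> carrier_vec (dim_col B)" "y = (A * B) *\<^sub>v x"
    unfolding mat_range_eq by auto
  have "y = A *\<^sub>v (B *\<^sub>v x)"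
    unfolding x(2)
    by (rule assoc_mult_mat_vec[of A "dim_row A" "dim_row B" B "dim_col B"]) (use assms x(1) in auto)
  moreover have "B *\<^sub>v x \<in> carrier_vec (dim_col A)" using assms by (auto intro: carrier_vecI)
  ultimately show "y \<in> mat_range A" unfolding mat_range_eq by blast
qed

text \<open>The entries of \<open>mat_adjoint W *\<^sub>v x\<close> are the inner products of
  \<open>x\<close> with the columns of \<open>W\<close>, which lie in the range as images of unit
  vectors.\<close>

lemma orth_compl_mat_range_subset:
  assumes W: "W \<in> carrier_mat n k"
  shows "orth_compl n (mat_range W) \<subseteq> mat_kernel (mat_adjoint W)"
proof
  fix x assume x: "x \<in> orth_compl n (mat_range W)"
  show "x \<in> mat_kernel (mat_adjoint W)"
  proof (rule mat_kernelI)
    show "x \<in> carrier_vec n" using x by (simp add: orth_compl_def)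
    show "mat_adjoint W *\<^sub>v x = 0\<^sub>v k"
    proof (rule eq_vecI)
      fix j assume j: "j < dim_vec (0\<^sub>v k :: complex vec)"
      have "col W j = W *\<^sub>v unit_vec k j" using W j by (intro eq_vecI) auto
      hence "col W j \<in> mat_range W" unfolding mat_range_eq using W by auto
      hence "x \<bullet>c col W j = 0" using x by (simp add: orth_compl_def)
      moreover have "(mat_adjoint W *\<^sub>v x) $ j = x \<bullet>c col W j"
        using W j x by (auto simp: orth_compl_def scalar_prod_def mult.commute intro!: sum.cong)
      ultimately show "(mat_adjoint W *\<^sub>v x) $ j = 0\<^sub>v k $ j" using j by simp
    qed (use W in auto)
  qed (use W in auto)
qed

lemma mat_kernel_mult_left_subset:
  fixes B C :: "'a :: comm_ring_1 mat"
  assumes "dim_col B = dim_row C"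
  shows "mat_kernel C \<subseteq> mat_kernel (B * C)"
proof
  fix x assume "x \<in> mat_kernel C"
  hence x: "x \<in> carrier_vec (dim_col C)" "C *\<^sub>v x = 0\<^sub>v (dim_row C)"
    by (auto simp: mat_kernel_def)
  have "(B * C) *\<^sub>v x = B *\<^sub>v (C *\<^sub>v x)"
    using assms x by (intro assoc_mult_mat_vec[of B "dim_row B" "dim_row C" C "dim_col C"]) auto
  also have "\<dots> = 0\<^sub>v (dim_row B)" unfolding x(2) using assms by (intro eq_vecI) (auto intro!: scalar_prod_right_zero carrier_vecI)
  finally show "x \<in> mat_kernel (B * C)" using x by (simp add: mat_kernel_def)
qed

text \<open>In \<open>X = X * (M * X)\<close> the Hermitian factor \<open>M * X\<close> is replaced
  by its adjoint, which exposes \<open>mat_adjoint M\<close> as the last factor.\<close>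

lemma pinv_factor:
  "pinv M = pinv M * (mat_adjoint (pinv M) * mat_adjoint M)"
proof -
  note p = is_pinv_pinv[of M, unfolded is_pinv_def]
  hence d: "dim_row (pinv M) = dim_col M" "dim_col (pinv M) = dim_row M" by auto
  have "mat_adjoint (pinv M) * mat_adjoint M = M * pinv M"
    using p d by (metis mat_adjoint_mult)
  with p d show ?thesis by (simp flip: mat_mult_assoc_dims)
qed

text \<open>Common form of both null space claims: \<open>T = S\<close>, \<open>L = A * V\<close>
  gives \<open>Phi_hat\<close>, and \<open>T = S * A\<close>, \<open>L = V\<close> gives
  \<open>Pi_hat\<close>. By \<open>pinv_factor\<close> the product ends in the adjoint of
  \<open>mat_adjoint T * M\<close>.\<close>

lemma orth_compl_kernel_pinv:
  assumes T: "T \<in> carrier_mat s n" and M: "M \<in> carrier_mat s m" and L: "L \<in> carrier_mat k m"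
  shows "orth_compl n (mat_range (mat_adjoint T * M)) \<subseteq> mat_kernel (L * pinv M * T)"
proof -
  have p: "pinv M \<in> carrier_mat m s" using is_pinv_pinv[of M] M by (auto simp: is_pinv_def)
  have "L * pinv M * T = L * (pinv M * (mat_adjoint (pinv M) * mat_adjoint M)) * T"
    using pinv_factor[of M] by simp
  also have "\<dots> = (L * pinv M * mat_adjoint (pinv M)) * mat_adjoint (mat_adjoint T * M)"
    using T M L p by (simp add: mat_mult_assoc_dims mat_adjoint_mult)
  finally have eq: "L * pinv M * T = \<dots>" .
  have "orth_compl n (mat_range (mat_adjoint T * M)) \<subseteq> mat_kernel (mat_adjoint (mat_adjoint T * M))"
    by (rule orth_compl_mat_range_subset[of _ n m]) (use T M in auto)
  also have "\<dots> \<subseteq> mat_kernel (L * pinv M * T)"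
    unfolding eq by (rule mat_kernel_mult_left_subset) (use M p in auto)
  finally show ?thesis .
qed

theorem lemma4p1:
  fixes A S V :: "complex mat" and r0 :: "complex vec" and N s m :: nat
  assumes "A \<in> carrier_mat N N"
    and "r0 \<in> carrier_vec N"
    and "S \<in> carrier_mat s N"
    and "V \<in> carrier_mat N m"
    and "columns_form_basis V (krylov A r0 m)"
  shows "projector (Pi_hat A S V) \<and> projector (Phi_hat A S V) \<and>
    mat_range (Phi_hat A S V) \<subseteq> mat_range (A * V) \<and>
    orth_compl N (mat_range (mat_adjoint S * S * A * V)) \<subseteq> mat_kernel (Phi_hat A S V) \<and>
    mat_range (Pi_hat A S V) \<subseteq> mat_range V \<and>
    orth_compl N (mat_range (mat_adjoint A * mat_adjoint S * S * A * V)) \<subseteq> mat_kernel (Pi_hat A S V)"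
proof -
  note A = assms(1) and S = assms(3) and V = assms(4)
  define M where "M = S * A * V"
  define X where "X = pinv M"
  have M: "M \<in> carrier_mat s m" using A S V by (auto simp: M_def)
  have pX: "is_pinv M X" unfolding X_def by (rule is_pinv_pinv)
  hence X: "X \<in> carrier_mat m s" using M by (auto simp: is_pinv_def)
  have "X * M * X = X" using pX by (simp add: is_pinv_def)
  \<comment> \<open>The product is nested to the right with a trailing factor \<open>Z\<close>, so
    that the rule still matches after simp has reassociated.\<close>
  hence XMX: "X * (S * (A * (V * (X * Z)))) = X * Z" if "dim_row Z = s" for Z
  proof -
    have "X * (S * (A * (V * (X * Z)))) = X * M * X * Z"
      using that A S V X by (simp add: M_def mat_mult_assoc_dims)
    thus ?thesis unfolding \<open>X * M * X = X\<close> .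
  qed
  have Phi: "Phi_hat A S V = (A * V) * X * S"
    by (simp add: Phi_hat_def X_def M_def)
  have Pi: "Pi_hat A S V = V * X * (S * A)"
    using A S V X by (simp add: Pi_hat_def mat_mult_assoc_dims flip: X_def M_def)
  have 1: "projector (Pi_hat A S V)"
    using A S V X by (simp add: projector_def Pi mat_mult_assoc_dims XMX)
  have 2: "projector (Phi_hat A S V)"
    using A S V X by (simp add: projector_def Phi mat_mult_assoc_dims XMX)
  have 3: "mat_range (Phi_hat A S V) \<subseteq> mat_range (A * V)"
    using mat_range_mult_subset[of "A * V" "X * S"] A S V X
    by (simp add: Phi mat_mult_assoc_dims)
  have 4: "mat_range (Pi_hat A S V) \<subseteq> mat_range V"
    using mat_range_mult_subset[of V "X * (S * A)"] A S V X
    by (simp add: Pi mat_mult_assoc_dims)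
  have 5: "orth_compl N (mat_range (mat_adjoint S * S * A * V)) \<subseteq> mat_kernel (Phi_hat A S V)"
    using orth_compl_kernel_pinv[OF S M, of "A * V" N] A S V
    by (simp add: Phi X_def M_def mat_mult_assoc_dims)
  have 6: "orth_compl N (mat_range (mat_adjoint A * mat_adjoint S * S * A * V)) \<subseteq> mat_kernel (Pi_hat A S V)"
    using orth_compl_kernel_pinv[of "S * A" s N M m V N] A S V M
    by (simp add: Pi X_def M_def mat_mult_assoc_dims mat_adjoint_mult)
  show ?thesis using 1 2 3 4 5 6 by blast
qed

end
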